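(* Let $q\ge 3$ be an odd integer. For every $r\ge 1$, $$\frac{1}{r}\binom{m_r-1}{r-1}\;\le\; a_q(r)\;\le\;\frac{1}{r}\binom{m_r}{r-1}.$$ For $r\ge 2$, lower equality holds if and only if $\delta_r$ is a strict record minimum: $$a_q(r)=\frac1r\binom{m_r-1}{r-1}\iff \delta_r<\delta_j\quad(1\le j<r),$$ and upper equality holds if and only if $\delta_r$ is a strict record maximum: $$a_q(r)=\frac1r\binom{m_r}{r-1}\iff \delta_r>\delta_j\quad(1\le j<r).$$ Equivalently, the lower equality orders are exactly the indices of strict record minima of the sequence $(M_q(r))_{r\ge1}$, and the upper equality orders are exactly the indices of its strict record maxima. The index $r=1$ is the unique $r\geq 1$ that is both a lower and an upper equality order.
   Context: For an odd integer $q\ge3$ put $\alpha_q=\log_2 q$ (irrational), $m_r=m_r(q)=\lfloor r\alpha_q\rfloor$, $\delta_r=\{r\alpha_q\}=r\alpha_q-m_r$, and $M_q(r)=q^r/2^{m_r}=2^{\delta_r}$. A $q$-admissible word of order $r\ge1$ is a finite word $w=(x_1,\dots,x_L)$ with each $x_j\in\{q/2,\,1/2\}$, containing exactly $r$ occurrences of $q/2$, such that $\prod_{j=1}^{\ell}x_j>1$ for all $1\le \ell<L$ and $\prod_{j=1}^{L}x_j<1$. Let $a_q(r)$ be the number of $q$-admissible words of order $r$. A lower (resp. upper) equality order is an integer $r\ge1$ with $a_q(r)=\frac1r\binom{m_r-1}{r-1}$ (resp. $a_q(r)=\frac1r\binom{m_r}{r-1}$). An index $r$ is a strict record minimum (resp.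 maximum) of a real sequence $(x_r)_{r\ge1}$ if $x_r<x_j$ (resp. $x_r>x_j$) for all $1\le j<r$; the index $r=1$ is trivially both. *)

theory Defs
  imports Complex_Main
begin

definition alpha :: "nat \<Rightarrow> real" where
  "alpha q = log 2 (real q)"

(* For q \<ge> 3 and r \<ge> 1 the floor is at least 1, so neither the conversion to nat
   nor the subtraction in "mfloor q r - 1" below truncates. *)
definition mfloor :: "nat \<Rightarrow> nat \<Rightarrow> nat" where
  "mfloor q r = nat \<lfloor>real r * alpha q\<rfloor>"

definition delta :: "nat \<Rightarrow> nat \<Rightarrow> real" where
  "delta q r = frac (real r * alpha q)"

definition Mseq :: "nat \<Rightarrow> nat \<Rightarrow> real" where
  "Mseq q r = real q ^ r / 2 ^ mfloor q r"

definition admissible_word :: "nat \<Rightarrow> nat \<Rightarrow> real list \<Rightarrow> bool" where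
  "admissible_word q r w \<longleftrightarrow>
     set w \<subseteq> {real q / 2, 1 / 2} \<and>
     count_list w (real q / 2) = r \<and>
     (\<forall>l. 1 \<le> l \<and> l < length w \<longrightarrow> prod_list (take l w) > 1) \<and>
     prod_list w < 1"

(* The counted set is finite: the last two conditions force length w = mfloor q r + 1. *)
definition a_count :: "nat \<Rightarrow> nat \<Rightarrow> nat" where
  "a_count q r = card {w. admissible_word q r w}"

definition lower_equality_order :: "nat \<Rightarrow> nat \<Rightarrow> bool" where
  "lower_equality_order q r \<longleftrightarrow>
     r \<ge> 1 \<and> real (a_count q r) = 1 / real r * real ((mfloor q r - 1) choose (r - 1))"

definition upper_equality_order :: "nat \<Rightarrow> nat \<Rightarrow> bool" where
  "upper_equality_order q r \<longleftrightarrow>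
     r \<ge> 1 \<and> real (a_count q r) = 1 / real r * real (mfloor q r choose (r - 1))"

(* Sequences are indexed from 1; the value at 0 is irrelevant. *)
definition strict_record_min :: "(nat \<Rightarrow> real) \<Rightarrow> nat \<Rightarrow> bool" where
  "strict_record_min x r \<longleftrightarrow> r \<ge> 1 \<and> (\<forall>j. 1 \<le> j \<and> j < r \<longrightarrow> x r < x j)"

definition strict_record_max :: "(nat \<Rightarrow> real) \<Rightarrow> nat \<Rightarrow> bool" where
  "strict_record_max x r \<longleftrightarrow> r \<ge> 1 \<and> (\<forall>j. 1 \<le> j \<and> j < r \<longrightarrow> x r > x j)"

end

theory Submission
  imports Defs
begin

text \<open>
  With \<open>\<beta> = \<alpha> - 1\<close>, an admissible word of order \<open>r\<close> is a list of \<open>r\<close> gaps with sum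
  \<open>\<lfloor>r \<beta>\<rfloor> + 1\<close> whose proper nonempty prefixes all have height
  \<open>l \<beta> - (g\<^sub>1 + \<dots> + g\<^sub>l) > 0\<close>; lowering the last gap by one gives such a list with sum \<open>\<lfloor>r \<beta>\<rfloor>\<close>.
  Both bounds come from the cycle lemma; call a list good if it satisfies the prefix-height
  condition. Among the \<open>r\<close> rotations of a list with sum \<open>\<lfloor>r \<beta>\<rfloor>\<close>
  (final height \<open>\<delta>\<^sub>r > 0\<close>) at least one is good, namely the one starting at the point of minimal
  height; among those of a list with sum \<open>\<lfloor>r \<beta>\<rfloor> + 1\<close> (final height \<open>\<delta>\<^sub>r - 1 < 0\<close>) at most one is.
  A height difference over \<open>j\<close> steps is congruent to \<open>\<delta>\<^sub>j\<close> modulo 1, so a second good rotation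
  forces some \<open>\<delta>\<^sub>j < \<delta>\<^sub>r\<close>, and the absence of a good one forces some \<open>\<delta>\<^sub>j > \<delta>\<^sub>r\<close>. Conversely,
  concatenating two good lists of lengths \<open>j\<close> and \<open>r - j\<close>, both of positive (respectively both of
  negative) final height, yields a list with two good rotations (respectively none).
\<close>

section \<open>Ballot sequences below a line of irrational slope\<close>

definition weak_comps :: "nat \<Rightarrow> nat \<Rightarrow> nat list set" where
  "weak_comps r s = {g. length g = r \<and> sum_list g = s}"

lemma finite_weak_comps: "finite (weak_comps r s)"
proof (rule finite_subset)
  show "weak_comps r s \<subseteq> {g. set g \<subseteq> {..s} \<and> length g = r}"
    using member_le_sum_list by (fastforce simp: weak_comps_def)
  show "finite {g. set g \<subseteq> {..s} \<and> length g = r}"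
    by (rule finite_lists_length_eq) simp
qed

lemma card_weak_comps:
  assumes "r > 0"
  shows "card (weak_comps r s) = (s + r - 1) choose (r - 1)"
proof -
  have "card (weak_comps r s) = (s + r - 1) choose s"
    using card_length_sum_list[of r s] by (simp add: weak_comps_def)
  also have "\<dots> = (s + r - 1) choose (r - 1)"
    using assms binomial_symmetric[of s "s + r - 1"] by simp
  finally show ?thesis .
qed

lemma rotate_in_weak_comps: "rotate i g \<in> weak_comps r s \<longleftrightarrow> g \<in> weak_comps r s"
proof -
  have "sum_list (rotate i g) = sum_list g"
    by (metis add.commute append_take_drop_id rotate_drop_take sum_list_append)
  then show ?thesis by (simp add: weak_comps_def)
qed

lemma ex_list_with_partial_sums:
  fixes p :: "nat \<Rightarrow> nat"
  assumes "p 0 = 0" and "\<And>i. i < r \<Longrightarrow> p i \<le> p (Suc i)"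
  obtains g where "length g = r" and "\<And>l. l \<le> r \<Longrightarrow> sum_list (take l g) = p l"
proof
  let ?g = "map (\<lambda>i. p (Suc i) - p i) [0..<r]"
  show "length ?g = r" by simp
  show "sum_list (take l ?g) = p l" if "l \<le> r" for l
    using that
  proof (induction l)
    case 0
    then show ?case using assms by simp
  next
    case (Suc l)
    then show ?case using assms(2)[of l] by (simp add: take_Suc_conv_app_nth)
  qed
qed

section \<open>Integer and fractional parts of multiples of an irrational slope\<close>

locale irrational_slope =
  fixes \<beta> :: real
  assumes slope_pos: "0 < \<beta>"
    and slope_irrational: "\<And>l::nat. 0 < l \<Longrightarrow> real l * \<beta> \<notin> \<int>"
begin

definition fl :: "nat \<Rightarrow> nat" where "fl l = nat \<lfloor>real l * \<beta>\<rfloor>"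

definition fr :: "nat \<Rightarrow> real" where "fr l = frac (real l * \<beta>)"

lemma fl_plus_fr: "real l * \<beta> = real (fl l) + fr l"
  using slope_pos by (simp add: fl_def fr_def frac_def)

lemma fr_nonneg: "0 \<le> fr l" and fr_less_1: "fr l < 1"
  by (simp_all add: fr_def frac_lt_1)

lemma fr_pos: "0 < l \<Longrightarrow> 0 < fr l"
  using slope_irrational by (simp add: fr_def)

lemma fl_mono: "k \<le> l \<Longrightarrow> fl k \<le> fl l"
  using slope_pos unfolding fl_def by (intro nat_mono floor_mono) simp

lemma fl_0 [simp]: "fl 0 = 0" and fr_0 [simp]: "fr 0 = 0"
  by (simp_all add: fl_def fr_def)

text \<open>The integer \<open>fl r - fl j - fl (r - j)\<close> equals
  \<open>fr j + fr (r - j) - fr r\<close>, which lies strictly between -1 and 2, so it is 0 or 1;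
  the order of \<open>fr j\<close> and \<open>fr r\<close> decides which.\<close>

lemma fr_less_iff_fl:
  assumes "j \<le> r"
  shows "fr j \<le> fr r \<longleftrightarrow> fl r = fl j + fl (r - j)"
    and "fr r < fr j \<longleftrightarrow> fl r = fl j + fl (r - j) + 1"
proof -
  have e: "real (r - j) * \<beta> = real r * \<beta> - real j * \<beta>"
    using assms by (simp add: of_nat_diff algebra_simps)
  have "real (fl r) - real (fl j) - real (fl (r - j)) = fr (r - j) + fr j - fr r"
    using e fl_plus_fr[of r] fl_plus_fr[of j] fl_plus_fr[of "r - j"] by linarith
  moreover note fr_nonneg[of "r - j"] fr_less_1[of "r - j"]
    fr_nonneg[of j] fr_less_1[of j] fr_nonneg[of r] fr_less_1[of r]
  ultimately show "fr j \<le> fr r \<longleftrightarrow> fl r = fl j + fl (r - j)"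
    and "fr r < fr j \<longleftrightarrow> fl r = fl j + fl (r - j) + 1"
    by linarith+
qed

lemma fr_inject:
  assumes "j < r"
  shows "fr j \<noteq> fr r"
proof
  assume *: "fr j = fr r"
  have "real (r - j) * \<beta> = real r * \<beta> - real j * \<beta>"
    using assms by (simp add: of_nat_diff algebra_simps)
  also have "\<dots> = of_int (int (fl r) - int (fl j))"
    using * fl_plus_fr[of r] fl_plus_fr[of j] by simp
  finally have "real (r - j) * \<beta> \<in> \<int>" by simp
  then show False using slope_irrational[of "r - j"] assms by simp
qed

section \<open>Heights and ballot lists\<close>

definition height :: "nat list \<Rightarrow> nat \<Rightarrow> real" where
  "height g l = real l * \<beta> - real (sum_list (take l g))"

text \<open>The height at \<open>l = r\<close> is left free: for positive \<open>r\<close> one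
  definition covers \<open>s = fl r\<close>, where the list ends above zero, and
  \<open>s = fl r + 1\<close>, where it ends below.\<close>

definition ballot :: "nat \<Rightarrow> nat \<Rightarrow> nat list set" where
  "ballot r s = {g \<in> weak_comps r s. \<forall>l. 0 < l \<and> l < r \<longrightarrow> 0 < height g l}"

text \<open>Starting positions are collected, not distinct rotated lists, so that periodic lists
  count with multiplicity and the double count below is exact.\<close>

definition good_rotations :: "nat list \<Rightarrow> nat set" where
  "good_rotations g = {i. i < length g \<and> rotate i g \<in> ballot (length g) (sum_list g)}"

lemma finite_good_rotations: "finite (good_rotations g)"
  by (simp add: good_rotations_def)

lemma height_0: "height g 0 = 0"
  by (simp add: height_def)

lemma height_length: "height g (length g) = real (length g) * \<beta> - real (sum_list g)"
  by (simp add: height_def)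

lemma height_diff:
  assumes "i \<le> l"
  obtains z :: int where "height g l - height g i = real (l - i) * \<beta> - of_int z"
proof
  show "height g l - height g i
      = real (l - i) * \<beta> - of_int (int (sum_list (take l g)) - int (sum_list (take i g)))"
    using assms by (simp add: height_def of_nat_diff algebra_simps)
qed

lemma height_inject:
  assumes "height g i = height g l"
  shows "i = l"
proof -
  have "\<not> a < b" if "height g a = height g b" for a b
  proof
    assume "a < b"
    then obtain z where "height g b - height g a = real (b - a) * \<beta> - of_int z"
      using height_diff[OF less_imp_le] by blast
    then have "real (b - a) * \<beta> = of_int z" using that by simp
    then show False using slope_irrational[of "b - a"] \<open>a < b\<close> by auto
  qed
  then show ?thesis using assms by (metis linorder_neqE_nat)
qed

text \<open>The difference is congruent to \<open>real (l - i) * \<beta>\<close> modulo 1, and the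
  least positive number in that class is the fractional part.\<close>

lemma fr_le_height_diff:
  assumes "i \<le> l" and "height g i < height g l"
  shows "fr (l - i) \<le> height g l - height g i"
proof -
  obtain z where z: "height g l - height g i = real (l - i) * \<beta> - of_int z"
    using height_diff assms by blast
  then have "z \<le> \<lfloor>real (l - i) * \<beta>\<rfloor>" using assms(2) by (simp add: le_floor_iff)
  then show ?thesis using z by (simp add: fr_def frac_def)
qed

text \<open>Read backwards, the difference is congruent to the negative of
  \<open>real (i - l) * \<beta>\<close> modulo 1, whence the complementary fraction.\<close>

lemma one_minus_fr_le_height_diff:
  assumes "l \<le> i" and "height g i < height g l"
  shows "1 - fr (i - l) \<le> height g l - height g i"
proof -
  obtain z where z: "height g i - height g l = real (i - l) * \<beta> - of_int z"
    using height_diff assms by blast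
  then have "real (i - l) * \<beta> < of_int z" using assms(2) by simp
  then have "\<lfloor>real (i - l) * \<beta>\<rfloor> + 1 \<le> z" by linarith
  then have "of_int (\<lfloor>real (i - l) * \<beta>\<rfloor> + 1) \<le> (of_int z :: real)" by (simp only: of_int_le_iff)
  then show ?thesis using z by (simp add: fr_def frac_def)
qed

section \<open>Rotations and the double count\<close>

lemma height_rotate:
  assumes "i < length g" and "l \<le> length g"
  shows "height (rotate i g) l =
    (if i + l \<le> length g then height g (i + l) - height g i
     else height g (i + l - length g) + height g (length g) - height g i)"
proof -
  have rot: "rotate i g = drop i g @ take i g"
    using assms by (simp add: rotate_drop_take)
  have total: "sum_list (take i g) + sum_list (drop i g) = sum_list g"
    by (metis append_take_drop_id sum_list_append)
  show ?thesis
  proof (cases "i + l \<le> length g")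
    case True
    have "take (i + l) g = take i g @ take l (drop i g)"
      by (simp add: take_add)
    then have "sum_list (take (i + l) g) = sum_list (take i g) + sum_list (take l (drop i g))"
      by simp
    with True rot show ?thesis by (simp add: height_def algebra_simps)
  next
    case False
    then have "i + l - length g \<le> i" using assms by linarith
    with False have "take l (rotate i g) = drop i g @ take (i + l - length g) g"
      using rot assms by (simp add: min_absorb1 add.commute)
    moreover have "real (i + l - length g) = real i + real l - real (length g)"
      using False by (simp add: of_nat_diff)
    moreover have "real (sum_list g) = real (sum_list (take i g)) + real (sum_list (drop i g))"
      using total by (simp flip: of_nat_add)
    ultimately show ?thesis using False by (simp add: height_def algebra_simps)
  qed
qed

text \<open>A path started at \<open>i\<close> first meets the later positions, then wraps around;
  positions before \<open>i\<close> are met shifted by the total height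
  \<open>real r * \<beta> - real s\<close>.\<close>

lemma good_rotations_iff:
  assumes "g \<in> weak_comps r s"
  shows "i \<in> good_rotations g \<longleftrightarrow> i < r \<and>
    (\<forall>l. i < l \<and> l < r \<longrightarrow> height g i < height g l) \<and>
    (\<forall>l<i. height g i < height g l + (real r * \<beta> - real s))" (is "_ \<longleftrightarrow> _ \<and> ?up \<and> ?wrap")
proof (cases "i < r")
  case True
  have [simp]: "length g = r" "sum_list g = s" using assms by (auto simp: weak_comps_def)
  have top: "height g r = real r * \<beta> - real s" using height_length[of g] by simp
  have "i \<in> good_rotations g \<longleftrightarrow> (\<forall>l. 0 < l \<and> l < r \<longrightarrow> 0 < height (rotate i g) l)"
    using True assms by (simp add: good_rotations_def ballot_def rotate_in_weak_comps)
  also have "\<dots> \<longleftrightarrow> ?up \<and> ?wrap"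
  proof (intro iffI conjI allI impI)
    fix l assume *: "\<forall>l. 0 < l \<and> l < r \<longrightarrow> 0 < height (rotate i g) l" and "i < l \<and> l < r"
    then have "0 < l - i" "l - i < r" "i + (l - i) = l" by linarith+
    then show "height g i < height g l"
      using * height_rotate[of i g "l - i"] True \<open>i < l \<and> l < r\<close>
      by (metis \<open>length g = r\<close> diff_gt_0_iff_gt less_imp_le)
  next
    fix l assume *: "\<forall>l. 0 < l \<and> l < r \<longrightarrow> 0 < height (rotate i g) l" and "l < i"
    then have "0 < height (rotate i g) (r - i + l)" using True by simp
    then show "height g i < height g l + (real r * \<beta> - real s)"
      \<comment> \<open>Position 0 is met exactly at the end of \<open>g\<close>, where
        \<open>height_rotate\<close> still uses its unwrapped branch; hence the split on
        \<open>l = 0\<close>.\<close>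
      using height_rotate[of i g "r - i + l"] True top \<open>l < i\<close>
      by (cases "l = 0") (simp_all add: height_0)
  next
    fix l assume *: "?up \<and> ?wrap" and l: "0 < l \<and> l < r"
    show "0 < height (rotate i g) l"
    proof (cases "i + l < r")
      case True
      then show ?thesis using * l height_rotate[of i g l] by auto
    next
      case False
      then have "i + l - r < i" using True l by linarith
      then have "height g i < height g (i + l - r) + height g r"
        using * top by simp
      then show ?thesis using False l True height_rotate[of i g l]
        by (cases "i + l = r") (auto simp: height_0)
    qed
  qed
  finally show ?thesis using True by simp
next
  case False
  then show ?thesis using assms by (simp add: good_rotations_def weak_comps_def)
qed

text \<open>Exchange the sums: for fixed \<open>i\<close>, rotation by \<open>i\<close> permutes
  \<open>weak_comps r s\<close>, so each of the \<open>r\<close> starting positions contributes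
  \<open>card (ballot r s)\<close>.\<close>

lemma sum_card_good_rotations:
  "(\<Sum>g\<in>weak_comps r s. card (good_rotations g)) = r * card (ballot r s)"
proof -
  let ?C = "weak_comps r s" and ?B = "ballot r s"
  have "(\<Sum>g\<in>?C. card (good_rotations g)) = (\<Sum>g\<in>?C. card {i\<in>{..<r}. rotate i g \<in> ?B})"
    by (rule sum.cong) (auto simp: good_rotations_def weak_comps_def intro!: arg_cong[where f=card])
  also have "\<dots> = (\<Sum>g\<in>?C. \<Sum>i<r. if rotate i g \<in> ?B then 1 else 0)"
    by (intro sum.cong refl) (simp add: sum.If_cases Int_def)
  also have "\<dots> = (\<Sum>i<r. \<Sum>g\<in>?C. if rotate i g \<in> ?B then 1 else 0)"
    by (rule sum.swap)
  also have "\<dots> = (\<Sum>i<r. card {g\<in>?C. rotate i g \<in> ?B})"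
    using finite_weak_comps by (simp add: sum.If_cases Int_def)
  also have "\<dots> = (\<Sum>i<r. card ?B)"
  proof (rule sum.cong[OF refl])
    fix i assume "i \<in> {..<r}"
    then have "bij_betw (rotate i) {g\<in>?C. rotate i g \<in> ?B} ?B"
      by (intro bij_betw_byWitness[where f' = "rotate (r - i)"])
        (auto simp: rotate_rotate rotate_id rotate_in_weak_comps, auto simp: ballot_def weak_comps_def rotate_id)
    then show "card {g\<in>?C. rotate i g \<in> ?B} = card ?B"
      by (rule bij_betw_same_card)
  qed
  finally show ?thesis by simp
qed

section \<open>Sum \<open>fl r\<close>: at least one good rotation\<close>

lemma ex_height_minimum:
  assumes "0 < r"
  obtains i where "i < r" and "\<And>l. l < r \<Longrightarrow> l \<noteq> i \<Longrightarrow> height g i < height g l"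
proof -
  obtain i where i: "i < r" and min: "\<forall>l<r. height g i \<le> height g l"
    using ex_min_if_finite[of "height g ` {..<r}"] assms by (force simp: not_less)
  \<comment> \<open>Irrationality makes heights at distinct positions distinct, so the minimum is
    strict.\<close>
  then have "height g i < height g l" if "l < r" "l \<noteq> i" for l
    using that height_inject[of g i l] by force
  with i that show ?thesis by blast
qed

lemma good_rotations_nonempty:
  assumes "0 < r" and g: "g \<in> weak_comps r (fl r)"
  shows "good_rotations g \<noteq> {}"
proof -
  obtain i where i: "i < r" and min: "\<And>l. l < r \<Longrightarrow> l \<noteq> i \<Longrightarrow> height g i < height g l"
    using ex_height_minimum assms(1) by blast
  have "0 < real r * \<beta> - real (fl r)"
    using fr_pos[OF assms(1)] fl_plus_fr[of r] by linarith
  then have "height g i < height g l + (real r * \<beta> - real (fl r))" if "l < i" for l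
    using min[of l] that i by fastforce
  then have "i \<in> good_rotations g"
    using i min by (subst good_rotations_iff[OF g]) auto
  then show ?thesis by blast
qed

text \<open>Two good starts \<open>i < k\<close> would have a height difference that is positive and
  below \<open>fr r\<close>, yet at least \<open>fr (k - i)\<close>.\<close>

lemma good_rotations_unique:
  assumes g: "g \<in> weak_comps r (fl r)" and rec: "\<And>j. 1 \<le> j \<Longrightarrow> j < r \<Longrightarrow> fr r < fr j"
  shows "card (good_rotations g) \<le> 1"
proof -
  have "\<not> i < k" if "i \<in> good_rotations g" "k \<in> good_rotations g" for i k
  proof
    assume "i < k"
    have "k < r" "height g i < height g k" "height g k < height g i + (real r * \<beta> - real (fl r))"
      using that \<open>i < k\<close> good_rotations_iff[OF g] by auto
    moreover have "fr r < fr (k - i)" using rec[of "k - i"] \<open>i < k\<close> \<open>k < r\<close> by linarith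
    ultimately show False
      using fr_le_height_diff[of i k g] \<open>i < k\<close> fl_plus_fr[of r] by linarith
  qed
  then have "i = k" if "i \<in> good_rotations g" "k \<in> good_rotations g" for i k
    using that by (metis linorder_neqE_nat)
  then show ?thesis by (simp add: card_le_Suc0_iff_eq finite_good_rotations)
qed

lemma ex_two_good_rotations:
  assumes j: "1 \<le> j" "j < r" and less: "fr j < fr r"
  obtains g where "g \<in> weak_comps r (fl r)" and "1 < card (good_rotations g)"
proof -
  \<comment> \<open>Two floor sequences glued at \<open>j\<close>, so that heights are fractional
    parts, restarting from \<open>fr j\<close>. The total is \<open>fl r\<close> because
    \<open>fr j < fr r\<close>.\<close>
  define p where "p l = (if l \<le> j then fl l else fl j + fl (l - j))" for l
  have flr: "fl r = fl j + fl (r - j)" using fr_less_iff_fl[of j r] j less by simp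
  have "p i \<le> p (Suc i)" for i
    using fl_mono[of i "Suc i"] fl_mono[of "i - j" "Suc i - j"] fl_mono[of i j]
    unfolding p_def by (auto intro: trans_le_add1)
  then obtain g where len: "length g = r" and g: "\<And>l. l \<le> r \<Longrightarrow> sum_list (take l g) = p l"
    using ex_list_with_partial_sums[of p r] fl_0 by (auto simp: p_def)
  have gC: "g \<in> weak_comps r (fl r)"
    using g[of r] len flr j by (simp add: weak_comps_def p_def)
  have h1: "height g l = fr l" if "l \<le> j" for l
    using that g[of l] j fl_plus_fr[of l] by (simp add: height_def p_def)
  have h2: "height g l = fr j + fr (l - j)" if "j \<le> l" "l \<le> r" for l
  proof -
    have "real l * \<beta> = real j * \<beta> + real (l - j) * \<beta>"
      using that by (simp add: of_nat_diff algebra_simps)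
    then show ?thesis
      using that g[of l] j fl_plus_fr[of j] fl_plus_fr[of "l - j"]
      by (auto simp: height_def p_def)
  qed
  have T: "real r * \<beta> - real (fl r) = fr r" using fl_plus_fr[of r] by linarith
  have up: "fr j < height g l" if "j < l" "l < r" for l
    using h2[of l] fr_pos[of "l - j"] that by simp
  have "0 < height g l" if "0 < l" "l < r" for l
    using h1[of l] up[of l] fr_pos[of l] fr_pos[of j] that j by (cases "l \<le> j") force+
  then have "0 \<in> good_rotations g"
    using j by (subst good_rotations_iff[OF gC]) (auto simp: height_0)
  \<comment> \<open>Wrapped positions before \<open>j\<close> have height
    \<open>fr l + fr r\<close>, which exceeds \<open>height g j = fr j\<close>.\<close>
  moreover have "j \<in> good_rotations g"
    using j up h1 less fr_nonneg unfolding good_rotations_iff[OF gC] T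
    by (auto simp: add.commute intro: less_le_trans add_strict_increasing)
  ultimately have "{0, j} \<subseteq> good_rotations g" by simp
  then have "card {0, j} \<le> card (good_rotations g)"
    by (intro card_mono finite_good_rotations)
  then have "1 < card (good_rotations g)" using j by simp
  with gC that show ?thesis by blast
qed

section \<open>Sum \<open>fl r + 1\<close>: at most one good rotation\<close>

lemma good_rotations_unique_upper:
  assumes g: "g \<in> weak_comps r (fl r + 1)"
  shows "card (good_rotations g) \<le> 1"
proof -
  have "real r * \<beta> - real (fl r + 1) \<le> 0"
    using fl_plus_fr[of r] fr_less_1[of r] by simp
  \<comment> \<open>For \<open>i < k\<close>, goodness of \<open>i\<close> makes \<open>k\<close>
    higher, while goodness of \<open>k\<close> makes \<open>i\<close> higher, since the wrap adds a
    nonpositive total.\<close>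
  then have "\<not> i < k" if "i \<in> good_rotations g" "k \<in> good_rotations g" for i k
    using that good_rotations_iff[OF g] by force
  then have "i = k" if "i \<in> good_rotations g" "k \<in> good_rotations g" for i k
    using that by (metis linorder_neqE_nat)
  then show ?thesis by (simp add: card_le_Suc0_iff_eq finite_good_rotations)
qed

text \<open>Start at the lowest point \<open>i\<close>: an earlier position \<open>l\<close> is
  higher by at least \<open>1 - fr (i - l)\<close>, which exceeds the loss \<open>1 - fr r\<close>
  of the wrap.\<close>

lemma good_rotations_nonempty_upper:
  assumes "0 < r" and g: "g \<in> weak_comps r (fl r + 1)"
    and rec: "\<And>j. 1 \<le> j \<Longrightarrow> j < r \<Longrightarrow> fr j < fr r"
  shows "good_rotations g \<noteq> {}"
proof -
  obtain i where i: "i < r" and min: "\<And>l. l < r \<Longrightarrow> l \<noteq> i \<Longrightarrow> height g i < height g l"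
    using ex_height_minimum assms(1) by blast
  have "height g i < height g l + (real r * \<beta> - real (fl r + 1))" if "l < i" for l
  proof -
    have "fr (i - l) < fr r" using rec[of "i - l"] that i by simp
    then show ?thesis
      using one_minus_fr_le_height_diff[of l i g] min[of l] that i fl_plus_fr[of r] by simp
  qed
  then have "i \<in> good_rotations g"
    using i min by (subst good_rotations_iff[OF g]) auto
  then show ?thesis by blast
qed

lemma ex_no_good_rotation:
  assumes j: "1 \<le> j" "j < r" and less: "fr r < fr j"
  obtains g where "g \<in> weak_comps r (fl r + 1)" and "good_rotations g = {}"
proof -
  \<comment> \<open>Two floor sequences glued at \<open>j\<close>, each with its last partial sum
    raised by one, so that each piece ends below its start; \<open>fr r < fr j\<close> makes the
    total \<open>fl r + 1\<close>.\<close>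
  define p where "p l = (if l < j then fl l else if l < r then fl j + 1 + fl (l - j) else fl r + 1)" for l
  have flr: "fl r = fl j + fl (r - j) + 1" using fr_less_iff_fl[of j r] j less by simp
  have "p i \<le> p (Suc i)" if "i < r" for i
    using that fl_mono[of i "Suc i"] fl_mono[of i j] fl_mono[of "i - j" "Suc i - j"] fl_mono[of "i - j" "r - j"] flr
    unfolding p_def by (auto intro: trans_le_add1 le_SucI)
  then obtain g where len: "length g = r" and g: "\<And>l. l \<le> r \<Longrightarrow> sum_list (take l g) = p l"
    using ex_list_with_partial_sums[of p r] fl_0 j by (auto simp: p_def)
  have gC: "g \<in> weak_comps r (fl r + 1)"
    using g[of r] len j by (simp add: weak_comps_def p_def)
  have T: "real r * \<beta> - real (fl r + 1) = fr r - 1" using fl_plus_fr[of r] by simp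
  have h1: "height g l = fr l" if "l < j" for l
    using that g[of l] j fl_plus_fr[of l] by (simp add: height_def p_def)
  have h2: "height g l = fr j - 1 + fr (l - j)" if "j \<le> l" "l < r" for l
  proof -
    have "real l * \<beta> = real j * \<beta> + real (l - j) * \<beta>"
      using that by (simp add: of_nat_diff algebra_simps)
    then show ?thesis
      using that g[of l] j fl_plus_fr[of j] fl_plus_fr[of "l - j"]
      by (auto simp: height_def p_def)
  qed
  have hj: "height g j = fr j - 1" using h2[of j] j by simp
  have False if "i \<in> good_rotations g" for i
  proof -
    have "i < r" and up: "\<And>l. i < l \<Longrightarrow> l < r \<Longrightarrow> height g i < height g l"
      and wrap: "\<And>l. l < i \<Longrightarrow> height g i < height g l + (fr r - 1)"
      using that good_rotations_iff[OF gC] T by auto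
    show False
    \<comment> \<open>A start before \<open>j\<close> fails at \<open>j\<close>, where the height is
      negative; a start at or after \<open>j\<close> fails against position 0 after the
      wrap.\<close>
    proof (cases "i < j")
      case True
      then have "fr i < fr j - 1" using up[of j] j h1[of i] hj by simp
      then show False using fr_nonneg[of i] fr_less_1[of j] by linarith
    next
      case False
      then have "fr j - 1 + fr (i - j) < fr r - 1"
        using wrap[of 0] h2[of i] \<open>i < r\<close> j by (simp add: height_0)
      then show False using less fr_nonneg[of "i - j"] by linarith
    qed
  qed
  with gC that show ?thesis by blast
qed

text \<open>The ballot conditions ignore the last gap, so raising it by one is a bijection once the
  larger lists are known to end in a positive gap.\<close>

lemma card_ballot_upper_eq_lower:
  assumes "0 < r"
  shows "card (ballot r (fl r + 1)) = card (ballot r (fl r))"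
proof (rule bij_betw_same_card[symmetric])
  let ?f = "\<lambda>g. butlast g @ [last g + 1]" and ?f' = "\<lambda>g. butlast g @ [last g - 1 :: nat]"
  have split: "sum_list g = sum_list (butlast g) + last g" if "g \<noteq> []" for g :: "nat list"
    using that by (metis append_butlast_last_id sum_list.Cons sum_list.Nil sum_list_append add_0_right)
  have ht: "height (butlast g @ [x]) l = height g l" if "l < length g" for g x l
    using that by (simp add: height_def take_butlast)
  have pos: "0 < last g" if g: "g \<in> ballot r (fl r + 1)" for g
  proof -
    have len: "length g = r" and sum: "sum_list g = fl r + 1"
      using g by (auto simp: ballot_def weak_comps_def)
    \<comment> \<open>The height before the last gap is nonnegative, so the other gaps sum to at
      most \<open>fl r\<close> and the last one must be positive.\<close>
    have "0 \<le> height g (r - 1)"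
      using g assms by (cases "r = 1") (auto simp: ballot_def height_0 less_imp_le)
    then have "real (sum_list (butlast g)) \<le> real (r - 1) * \<beta>"
      using len by (simp add: height_def butlast_conv_take)
    also have "\<dots> \<le> real r * \<beta>" using slope_pos by simp
    finally have "sum_list (butlast g) \<le> fl r" by (simp add: fl_def le_nat_iff le_floor_iff)
    then show ?thesis using split[of g] sum len assms by fastforce
  qed
  show "bij_betw ?f (ballot r (fl r)) (ballot r (fl r + 1))"
  proof (rule bij_betw_byWitness[where f' = ?f'])
    show "\<forall>g\<in>ballot r (fl r). ?f' (?f g) = g"
      using assms by (auto simp: ballot_def weak_comps_def)
    show "\<forall>g\<in>ballot r (fl r + 1). ?f (?f' g) = g"
      using assms pos by (auto simp: ballot_def weak_comps_def append_butlast_last_id)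
    show "?f ` ballot r (fl r) \<subseteq> ballot r (fl r + 1)"
    proof (rule image_subsetI)
      fix g assume g: "g \<in> ballot r (fl r)"
      then have "g \<noteq> []" using assms by (auto simp: ballot_def weak_comps_def)
      then show "?f g \<in> ballot r (fl r + 1)"
        using g split[of g] ht[of _ g] assms by (auto simp: ballot_def weak_comps_def)
    qed
    show "?f' ` ballot r (fl r + 1) \<subseteq> ballot r (fl r)"
    proof (rule image_subsetI)
      fix g assume g: "g \<in> ballot r (fl r + 1)"
      then have "g \<noteq> []" using assms by (auto simp: ballot_def weak_comps_def)
      then show "?f' g \<in> ballot r (fl r)"
        using g split[of g] ht[of _ g] pos[OF g] assms by (auto simp: ballot_def weak_comps_def)
    qed
  qed
qed

section \<open>Binomial bounds and their equality cases\<close>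

lemma ballot_lower_bound:
  assumes "0 < r"
  shows "(fl r + r - 1) choose (r - 1) \<le> r * card (ballot r (fl r))"
    and "r * card (ballot r (fl r)) = (fl r + r - 1) choose (r - 1) \<longleftrightarrow>
      (\<forall>j. 1 \<le> j \<and> j < r \<longrightarrow> fr r < fr j)"
proof -
  let ?C = "weak_comps r (fl r)"
  have sum: "(\<Sum>g\<in>?C. card (good_rotations g)) = r * card (ballot r (fl r))"
    by (rule sum_card_good_rotations)
  have cC: "(fl r + r - 1) choose (r - 1) = (\<Sum>g\<in>?C. 1)"
    using card_weak_comps[OF assms, of "fl r"] by simp
  have ge: "1 \<le> card (good_rotations g)" if "g \<in> ?C" for g
    using good_rotations_nonempty[OF assms that] finite_good_rotations
    by (simp add: Suc_le_eq card_gt_0_iff)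
  show "(fl r + r - 1) choose (r - 1) \<le> r * card (ballot r (fl r))"
    unfolding cC sum[symmetric] by (rule sum_mono) (rule ge)
  show "r * card (ballot r (fl r)) = (fl r + r - 1) choose (r - 1) \<longleftrightarrow>
      (\<forall>j. 1 \<le> j \<and> j < r \<longrightarrow> fr r < fr j)"
  proof
    assume rec: "\<forall>j. 1 \<le> j \<and> j < r \<longrightarrow> fr r < fr j"
    have "card (good_rotations g) = 1" if "g \<in> ?C" for g
      using ge[OF that] good_rotations_unique[OF that] rec by (simp add: le_antisym)
    then show "r * card (ballot r (fl r)) = (fl r + r - 1) choose (r - 1)"
      unfolding cC sum[symmetric] by simp
  next
    assume eq: "r * card (ballot r (fl r)) = (fl r + r - 1) choose (r - 1)"
    show "\<forall>j. 1 \<le> j \<and> j < r \<longrightarrow> fr r < fr j"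
    proof (rule ccontr)
      assume "\<not> (\<forall>j. 1 \<le> j \<and> j < r \<longrightarrow> fr r < fr j)"
      then obtain j where "1 \<le> j" "j < r" "fr j < fr r"
        using fr_inject by (meson linorder_neqE_linordered_idom)
      then obtain g where "g \<in> ?C" "1 < card (good_rotations g)"
        by (rule ex_two_good_rotations)
      then have "(\<Sum>g\<in>?C. 1) < (\<Sum>g\<in>?C. card (good_rotations g))"
        using ge finite_weak_comps by (intro sum_strict_mono_ex1) auto
      then show False using eq cC sum by simp
    qed
  qed
qed

lemma ballot_upper_bound:
  assumes "0 < r"
  shows "r * card (ballot r (fl r)) \<le> (fl r + r) choose (r - 1)"
    and "r * card (ballot r (fl r)) = (fl r + r) choose (r - 1) \<longleftrightarrow>
      (\<forall>j. 1 \<le> j \<and> j < r \<longrightarrow> fr j < fr r)"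
proof -
  let ?C = "weak_comps r (fl r + 1)"
  \<comment> \<open>The double count takes place at sum \<open>fl r + 1\<close>; the last-gap
    bijection makes both bounds concern the same number.\<close>
  have sum: "(\<Sum>g\<in>?C. card (good_rotations g)) = r * card (ballot r (fl r))"
    using sum_card_good_rotations[of r "fl r + 1"] card_ballot_upper_eq_lower[OF assms] by simp
  have cC: "(fl r + r) choose (r - 1) = (\<Sum>g\<in>?C. 1)"
    using card_weak_comps[OF assms, of "fl r + 1"] by simp
  have le: "card (good_rotations g) \<le> 1" if "g \<in> ?C" for g
    using good_rotations_unique_upper that by blast
  show "r * card (ballot r (fl r)) \<le> (fl r + r) choose (r - 1)"
    unfolding cC sum[symmetric] by (rule sum_mono) (rule le)
  show "r * card (ballot r (fl r)) = (fl r + r) choose (r - 1) \<longleftrightarrow>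
      (\<forall>j. 1 \<le> j \<and> j < r \<longrightarrow> fr j < fr r)"
  proof
    assume rec: "\<forall>j. 1 \<le> j \<and> j < r \<longrightarrow> fr j < fr r"
    have "card (good_rotations g) = 1" if "g \<in> ?C" for g
    proof -
      have "good_rotations g \<noteq> {}"
        using good_rotations_nonempty_upper[OF assms that] rec by blast
      then show ?thesis
        using le[OF that] finite_good_rotations[of g] card_gt_0_iff[of "good_rotations g"] by linarith
    qed
    then show "r * card (ballot r (fl r)) = (fl r + r) choose (r - 1)"
      unfolding cC sum[symmetric] by simp
  next
    assume eq: "r * card (ballot r (fl r)) = (fl r + r) choose (r - 1)"
    show "\<forall>j. 1 \<le> j \<and> j < r \<longrightarrow> fr j < fr r"
    proof (rule ccontr)
      assume "\<not> (\<forall>j. 1 \<le> j \<and> j < r \<longrightarrow> fr j < fr r)"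
      then obtain j where "1 \<le> j" "j < r" "fr r < fr j"
        using fr_inject by (meson linorder_neqE_linordered_idom)
      then obtain g where "g \<in> ?C" "good_rotations g = {}"
        by (rule ex_no_good_rotation)
      then have "(\<Sum>g\<in>?C. card (good_rotations g)) < (\<Sum>g\<in>?C. 1)"
        using le finite_weak_comps by (intro sum_strict_mono_ex1 bexI[of _ g]) auto
      then show False using eq cC sum by simp
    qed
  qed
qed

end

section \<open>Admissible words as ballot sequences\<close>

definition encode :: "real \<Rightarrow> nat list \<Rightarrow> real list" where
  "encode q g = concat (map (\<lambda>k. q / 2 # replicate k (1 / 2)) g)"

lemma encode_Nil [simp]: "encode q [] = []"
  and encode_Cons: "encode q (k # g) = q / 2 # replicate k (1 / 2) @ encode q g"
  and encode_append: "encode q (g @ h) = encode q g @ encode q h"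
  by (simp_all add: encode_def)

lemma length_encode: "length (encode q g) = length g + sum_list g"
  by (induction g) (auto simp: encode_Cons)

lemma set_encode: "set (encode q g) \<subseteq> {q / 2, 1 / 2}"
  by (auto simp: encode_def)

lemma count_encode: "q \<noteq> 1 \<Longrightarrow> count_list (encode q g) (q / 2) = length g"
  by (induction g) (auto simp: encode_Cons count_list_0_iff)

lemma prod_list_encode: "prod_list (encode q g) = q ^ length g / 2 ^ (length g + sum_list g)"
  by (induction g) (auto simp: encode_Cons power_add power_divide)

text \<open>The leading run of halves allows for suffixes cut inside a block; reading letters from
  the right, a \<open>q / 2\<close> turns the current run into a gap.\<close>

lemma ex_encode:
  assumes "set w \<subseteq> {q / 2, 1 / 2}"
  obtains k g where "w = replicate k (1 / 2) @ encode q g"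
proof -
  have "\<exists>k g. w = replicate k (1 / 2) @ encode q g"
    using assms
  proof (induction w)
    case Nil
    then show ?case by (intro exI[of _ 0] exI[of _ "[]"]) simp
  next
    case (Cons x w)
    then obtain k g where w: "w = replicate k (1 / 2) @ encode q g" by auto
    show ?case
    proof (cases "x = q / 2")
      case True
      then show ?thesis using w by (intro exI[of _ 0] exI[of _ "k # g"]) (simp add: encode_Cons)
    next
      case False
      then show ?thesis using w Cons.prems
        by (intro exI[of _ "Suc k"] exI[of _ g]) simp
    qed
  qed
  with that show thesis by blast
qed

text \<open>The induction carries a leading run of halves: once the first \<open>q / 2\<close> is
  removed, its gap becomes the leading run of the remainder.\<close>

lemma encode_inject:
  assumes "q \<noteq> 1" and "encode q g = encode q h"
  shows "g = h"
proof -
  have "k = l \<and> g = h"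
    if "replicate k (1 / 2) @ encode q g = replicate l (1 / 2) @ encode q h" for k l
    using that
  proof (induction g arbitrary: h k l)
    case Nil
    then have "count_list (replicate k (1 / 2)) (q / 2)
        = count_list (replicate l (1 / 2) @ encode q h) (q / 2)"
      by simp
    then have "h = []"
      using assms(1) by (simp add: count_encode count_list_0_iff)
    then show ?case using Nil arg_cong[where f = length] by fastforce
  next
    case (Cons a g)
    from Cons.prems have "count_list (replicate k (1 / 2) @ encode q (a # g)) (q / 2)
        = count_list (replicate l (1 / 2) @ encode q h) (q / 2)"
      by simp
    then have "length h = Suc (length g)"
      using assms(1) by (simp add: count_encode count_list_0_iff)
    then obtain b h' where h: "h = b # h'" by (cases h) auto
    have "takeWhile (\<lambda>x. x = 1 / 2) (replicate k (1 / 2) @ encode q (a # g)) = replicate k (1 / 2)"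
      "takeWhile (\<lambda>x. x = 1 / 2) (replicate l (1 / 2) @ encode q h) = replicate l (1 / 2)"
      using assms(1) by (simp_all add: encode_Cons h takeWhile_append)
    with Cons.prems have "k = l" by (metis length_replicate)
    then show ?case using Cons.IH[of a b h'] Cons.prems by (simp add: encode_Cons h)
  qed
  from this[of 0 0] show ?thesis using assms(2) by simp
qed

section \<open>The slope \<open>alpha q - 1\<close> for odd \<open>q\<close>\<close>

locale odd_multiplier =
  fixes q :: nat
  assumes odd_q: "odd q" and q_ge_3: "3 \<le> q"
begin

lemma power_q_eq_powr: "real q ^ n = 2 powr (real n * alpha q)"
proof -
  have "2 powr (real n * alpha q) = (2 powr alpha q) powr real n"
    by (simp add: powr_powr mult.commute)
  also have "\<dots> = real q ^ n"
    using q_ge_3 by (simp add: alpha_def powr_realpow)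
  finally show ?thesis ..
qed

text \<open>The slope is the binary logarithm of the letter \<open>q / 2\<close>. An integral
  multiple would give \<open>q ^ l = 2 ^ k\<close> with an odd left side exceeding 1.\<close>

sublocale irrational_slope "alpha q - 1"
proof
  have "log 2 2 < log 2 (real q)" using q_ge_3 by (subst log_less_cancel_iff) auto
  then show "0 < alpha q - 1" by (simp add: alpha_def)
next
  fix l :: nat assume "0 < l"
  show "real l * (alpha q - 1) \<notin> \<int>"
  proof
    assume "real l * (alpha q - 1) \<in> \<int>"
    then have "real l * (alpha q - 1) + real l \<in> \<int>" by (intro Ints_add) auto
    then have "real l * alpha q \<in> \<int>" by (simp add: algebra_simps)
    moreover have "0 \<le> real l * alpha q" using q_ge_3 by (simp add: alpha_def)
    ultimately obtain k :: nat where k: "real l * alpha q = real k"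
      by (metis Ints_cases of_int_0_le_iff of_int_of_nat_eq zero_le_imp_eq_int)
    then have "real (q ^ l) = real (2 ^ k)" by (simp add: power_q_eq_powr powr_realpow)
    then have "q ^ l = 2 ^ k" by (simp only: of_nat_eq_iff)
    moreover have "1 < q ^ l" using q_ge_3 \<open>0 < l\<close> by (intro one_less_power) auto
    moreover have "odd (q ^ l)" using odd_q by simp
    ultimately show False by (cases k) auto
  qed
qed

text \<open>Hence the two binomials of the theorem count the weak compositions of
  \<open>fl r\<close> and of \<open>fl r + 1\<close> into \<open>r\<close> parts.\<close>

lemma mfloor_eq: "mfloor q r = fl r + r"
proof -
  have "real r * alpha q = real r * (alpha q - 1) + of_int (int r)" by (simp add: algebra_simps)
  then have "\<lfloor>real r * alpha q\<rfloor> = \<lfloor>real r * (alpha q - 1)\<rfloor> + int r" by (simp only: floor_add_int)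
  then show ?thesis using slope_pos by (simp add: mfloor_def fl_def nat_add_distrib)
qed

lemma delta_eq: "delta q r = fr r"
proof -
  have "real r * alpha q = real (mfloor q r) + fr r"
    using fl_plus_fr[of r] by (simp add: mfloor_eq algebra_simps)
  then show ?thesis using fr_nonneg[of r] fr_less_1[of r]
    by (simp add: delta_def frac_unique_iff)
qed

lemma Mseq_eq: "Mseq q r = 2 powr fr r"
proof -
  have "Mseq q r = 2 powr (real r * alpha q - real (mfloor q r))"
    by (simp add: Mseq_def power_q_eq_powr powr_diff powr_realpow)
  also have "real r * alpha q - real (mfloor q r) = fr r"
    using fl_plus_fr[of r] by (simp add: mfloor_eq algebra_simps)
  finally show ?thesis .
qed

section \<open>From word products to heights\<close>

lemma prod_list_encode_powr:
  "prod_list (encode q g) = 2 powr (real (length g) * (alpha q - 1) - real (sum_list g))"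
proof -
  have "prod_list (encode q g)
      = 2 powr (real (length g) * alpha q) / 2 powr real (length g + sum_list g)"
    by (simp only: prod_list_encode power_q_eq_powr) (simp add: powr_realpow flip: of_nat_add)
  also have "\<dots> = 2 powr (real (length g) * (alpha q - 1) - real (sum_list g))"
    by (simp add: powr_diff[symmetric] algebra_simps)
  finally show ?thesis .
qed

lemma prod_list_encode_gt_1_iff:
  "1 < prod_list (encode q g) \<longleftrightarrow> real (sum_list g) < real (length g) * (alpha q - 1)"
  and prod_list_encode_less_1_iff:
  "prod_list (encode q g) < 1 \<longleftrightarrow> real (length g) * (alpha q - 1) < real (sum_list g)"
  using powr_less_cancel_iff[of 2 0] powr_less_cancel_iff[of 2 _ 0]
  by (simp_all add: prod_list_encode_powr)

text \<open>A prefix may cut a block, so its gap list is an initial piece of \<open>g\<close> with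
  the last gap possibly shortened, which can only raise the height.\<close>

lemma admissible_encode:
  assumes "1 \<le> r" and g: "g \<in> ballot r (fl r + 1)"
  shows "admissible_word q r (encode q g)"
  unfolding admissible_word_def
proof (intro conjI allI impI)
  have len: "length g = r" and sum: "sum_list g = fl r + 1"
    using g by (auto simp: ballot_def weak_comps_def)
  have q1: "real q \<noteq> 1" using q_ge_3 by simp
  show "set (encode q g) \<subseteq> {real q / 2, 1 / 2}" by (rule set_encode)
  show "count_list (encode q g) (real q / 2) = r" using q1 len by (simp add: count_encode)
  show "prod_list (encode q g) < 1"
    using fl_plus_fr[of r] fr_less_1[of r] len sum by (simp add: prod_list_encode_less_1_iff)
  fix l assume l: "1 \<le> l \<and> l < length (encode q g)"
  have "set (take l (encode q g)) \<subseteq> {real q / 2, 1 / 2}"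
    "set (drop l (encode q g)) \<subseteq> {real q / 2, 1 / 2}"
    using set_encode by (metis set_take_subset set_drop_subset subset_trans)+
  then obtain k h k' h' where t: "take l (encode q g) = replicate k (1 / 2) @ encode q h"
    and d: "drop l (encode q g) = replicate k' (1 / 2) @ encode q h'"
    by (metis ex_encode)
  have "hd (take l (encode q g)) = real q / 2"
    using l len assms(1) by (cases g) (auto simp: encode_Cons)
  then have "k = 0" using t q1 by (cases k) auto
  moreover have "take l (encode q g) \<noteq> []" using l by auto
  ultimately have "h \<noteq> []" using t by auto
  then obtain h0 a where h: "h = h0 @ [a]" by (metis append_butlast_last_id)
  have "encode q g = encode q (h0 @ (a + k') # h')"
    using append_take_drop_id[of l "encode q g"] t d \<open>k = 0\<close>
    by (simp add: h encode_append encode_Cons replicate_add)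
  then have g_eq: "g = h0 @ (a + k') # h'" using encode_inject q1 by blast
  have "real (sum_list h) < real (length h) * (alpha q - 1)"
  \<comment> \<open>If no block follows, the cut removes at least one half and leaves sum at most
    \<open>fl r\<close>; otherwise the ballot condition at \<open>length h\<close> applies.\<close>
  proof (cases "h' = []")
    case True
    then have "0 < k'" using d l by (cases k') auto
    then have "sum_list h \<le> fl r" using sum g_eq True h by simp
    then have "real (sum_list h) \<le> real (fl r)" by simp
    also have "\<dots> < real r * (alpha q - 1)"
      using fl_plus_fr[of r] fr_pos[of r] assms(1) by linarith
    also have "r = length h" using len g_eq True h by simp
    finally show ?thesis .
  next
    case False
    then have "0 < height g (length h)"
      using g g_eq h len by (auto simp: ballot_def)
    then show ?thesis using g_eq h by (simp add: height_def)
  qed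
  then show "1 < prod_list (take l (encode q g))"
    using t \<open>k = 0\<close> by (simp add: prod_list_encode_gt_1_iff)
qed

text \<open>Prefixes ending at block boundaries give the ballot conditions; the whole word and the
  word without its last letter pin the sum to \<open>fl r + 1\<close>.\<close>

lemma admissible_imp_encode:
  assumes "1 \<le> r" and w: "admissible_word q r w"
  obtains g where "g \<in> ballot r (fl r + 1)" and "w = encode q g"
proof -
  have q1: "real q \<noteq> 1" using q_ge_3 by simp
  have "set w \<subseteq> {real q / 2, 1 / 2}" and count: "count_list w (real q / 2) = r"
    and pre: "\<And>l. 1 \<le> l \<Longrightarrow> l < length w \<Longrightarrow> 1 < prod_list (take l w)"
    and less: "prod_list w < 1"
    using w by (auto simp: admissible_word_def)
  then obtain k g where kg: "w = replicate k (1 / 2) @ encode q g" by (metis ex_encode)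
  have len: "length g = r"
    using count kg q1 by (simp add: count_encode count_list_0_iff)
  have "k = 0"
  proof (rule ccontr)
    assume "k \<noteq> 0"
    then obtain k' where "k = Suc k'" by (cases k) auto
    then have "take 1 w = [1 / 2]" "1 < length w"
      using kg len assms(1) by (auto simp: length_encode)
    then show False using pre[of 1] by simp
  qed
  then have w_eq: "w = encode q g" using kg by simp
  have pos: "real (sum_list h) < real (length h) * (alpha q - 1)"
    if "w = encode q h @ v" "h \<noteq> []" "v \<noteq> []" for h v
  proof -
    have "1 < prod_list (take (length (encode q h)) w)"
      using that by (intro pre) (auto simp: length_encode Suc_le_eq)
    then show ?thesis using that by (simp add: prod_list_encode_gt_1_iff)
  qed
  have height: "0 < height g l" if "0 < l" "l < r" for l
  proof -
    have "w = encode q (take l g) @ encode q (drop l g)"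
      by (simp add: w_eq flip: encode_append)
    moreover have "encode q (drop l g) \<noteq> []"
      using that len length_encode[of q "drop l g"] by force
    ultimately show ?thesis using pos[of "take l g"] that len by (force simp: height_def)
  qed
  have top: "real r * (alpha q - 1) < real (sum_list g)"
    using less by (simp add: w_eq prod_list_encode_less_1_iff len)
  obtain g0 b where g_eq: "g = g0 @ [b]"
    using len assms(1) by (metis append_butlast_last_id length_0_conv not_one_le_zero)
  \<comment> \<open>With last gap zero, the final step would rise from a nonnegative height, against
    the product below 1.\<close>
  have "b \<noteq> 0"
  proof
    assume "b = 0"
    have "0 \<le> height g (r - 1)"
      using height[of "r - 1"] assms(1) by (cases "r = 1") (auto simp: height_0)
    then have "real (sum_list g) \<le> real (r - 1) * (alpha q - 1)"
      using \<open>b = 0\<close> g_eq len by (simp add: height_def)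
    also have "\<dots> \<le> real r * (alpha q - 1)" using slope_pos by simp
    finally show False using top by simp
  qed
  then obtain b' where b: "b = Suc b'" by (cases b) auto
  \<comment> \<open>Deleting the final half leaves a proper prefix, so \<open>sum_list g\<close>
    exceeds \<open>real r * (alpha q - 1)\<close> by less than 1.\<close>
  have "w = encode q (g0 @ [b']) @ [1 / 2]"
    by (simp add: w_eq g_eq b encode_append encode_Cons flip: replicate_append_same)
  then have "real (sum_list (g0 @ [b'])) < real r * (alpha q - 1)"
    using pos[of "g0 @ [b']" "[1 / 2]"] len g_eq by fastforce
  then have "real (sum_list g) < real r * (alpha q - 1) + 1" using g_eq b by simp
  then have "sum_list g = fl r + 1"
    using top fl_plus_fr[of r] fr_nonneg[of r] fr_less_1[of r] by linarith
  then have "g \<in> ballot r (fl r + 1)"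
    using len height by (simp add: ballot_def weak_comps_def)
  with w_eq that show thesis by blast
qed

section \<open>Counting admissible words and equality orders\<close>

lemma a_count_eq:
  assumes "1 \<le> r"
  shows "a_count q r = card (ballot r (fl r))"
proof -
  have "{w. admissible_word q r w} = encode q ` ballot r (fl r + 1)"
    using admissible_encode[OF assms] admissible_imp_encode[OF assms] by blast
  moreover have "inj_on (encode q) (ballot r (fl r + 1))"
    using encode_inject[of "real q"] q_ge_3 by (intro inj_onI) simp
  ultimately show ?thesis
    using card_ballot_upper_eq_lower[of r] assms by (simp add: a_count_def card_image)
qed

lemma a_count_bounds:
  assumes "1 \<le> r"
  shows "1 / real r * real ((mfloor q r - 1) choose (r - 1)) \<le> real (a_count q r)" (is ?lower)
    and "real (a_count q r) \<le> 1 / real r * real (mfloor q r choose (r - 1))" (is ?upper)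
    and "real (a_count q r) = 1 / real r * real ((mfloor q r - 1) choose (r - 1)) \<longleftrightarrow>
      (\<forall>j. 1 \<le> j \<and> j < r \<longrightarrow> fr r < fr j)" (is "?lower_eq \<longleftrightarrow> ?min")
    and "real (a_count q r) = 1 / real r * real (mfloor q r choose (r - 1)) \<longleftrightarrow>
      (\<forall>j. 1 \<le> j \<and> j < r \<longrightarrow> fr j < fr r)" (is "?upper_eq \<longleftrightarrow> ?max")
proof -
  have r: "0 < r" using assms by simp
  have le: "1 / real r * real x \<le> real y \<longleftrightarrow> x \<le> r * y"
    and ge: "real y \<le> 1 / real r * real x \<longleftrightarrow> r * y \<le> x"
    and eq: "real y = 1 / real r * real x \<longleftrightarrow> r * y = x" for x y
    using r by (simp_all add: field_simps flip: of_nat_mult)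
  note simps = le ge eq mfloor_eq a_count_eq[OF assms]
  show ?lower unfolding simps using ballot_lower_bound(1)[OF r] .
  show ?upper unfolding simps using ballot_upper_bound(1)[OF r] .
  show "?lower_eq \<longleftrightarrow> ?min" unfolding simps using ballot_lower_bound(2)[OF r] .
  show "?upper_eq \<longleftrightarrow> ?max" unfolding simps using ballot_upper_bound(2)[OF r] .
qed

lemma equality_orders:
  shows "lower_equality_order q r \<longleftrightarrow> strict_record_min (Mseq q) r"
    and "upper_equality_order q r \<longleftrightarrow> strict_record_max (Mseq q) r"
  using a_count_bounds(3,4)[of r]
  by (auto simp: lower_equality_order_def upper_equality_order_def
      strict_record_min_def strict_record_max_def Mseq_eq)

text \<open>For \<open>r > 1\<close> the two record conditions compare with index 1 in opposite
  directions.\<close>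

lemma lower_and_upper_equality_order_iff:
  "lower_equality_order q r \<and> upper_equality_order q r \<longleftrightarrow> r = 1"
proof
  assume "lower_equality_order q r \<and> upper_equality_order q r"
  then have "1 \<le> r" "1 < r \<Longrightarrow> Mseq q r < Mseq q 1 \<and> Mseq q 1 < Mseq q r"
    by (auto simp: equality_orders strict_record_min_def strict_record_max_def)
  then show "r = 1" by force
qed (auto simp: equality_orders strict_record_min_def strict_record_max_def)

end

theorem theorem6:
  fixes q :: nat
  assumes "odd q" and "q \<ge> 3"
  shows
    "(\<forall>r\<ge>1. 1 / real r * real ((mfloor q r - 1) choose (r - 1)) \<le> real (a_count q r) \<and>
             real (a_count q r) \<le> 1 / real r * real (mfloor q r choose (r - 1))) \<and>
     (\<forall>r\<ge>2. real (a_count q r) = 1 / real r * real ((mfloor q r - 1) choose (r - 1)) \<longleftrightarrow>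
             (\<forall>j. 1 \<le> j \<and> j < r \<longrightarrow> delta q r < delta q j)) \<and>
     (\<forall>r\<ge>2. real (a_count q r) = 1 / real r * real (mfloor q r choose (r - 1)) \<longleftrightarrow>
             (\<forall>j. 1 \<le> j \<and> j < r \<longrightarrow> delta q r > delta q j)) \<and>
     {r. lower_equality_order q r} = {r. strict_record_min (Mseq q) r} \<and>
     {r. upper_equality_order q r} = {r. strict_record_max (Mseq q) r} \<and>
     (\<forall>r\<ge>1. lower_equality_order q r \<and> upper_equality_order q r \<longleftrightarrow> r = 1)"
proof -
  interpret odd_multiplier q using assms by unfold_locales
  show ?thesis
    using a_count_bounds lower_and_upper_equality_order_iff
    by (simp add: delta_eq equality_orders del: One_nat_def)
qed

end
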